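(* Let $P$ and $Q$ be finite naturally labeled posets with $\operatorname{supp}_L(K_P(\mathbf{x}))=\operatorname{supp}_L(K_Q(\mathbf{x}))$. Then $\operatorname{sh}(P)=\operatorname{sh}(Q)$.
   Context: A poset $(P,\preceq)$ on ground set $[n]=\{1,\dots,n\}$ is naturally labeled if $x\preceq y$ implies $x\le y$ as integers. For such $P$, the $P$-partition generating function is $K_P(\mathbf{x})=\sum_{\sigma}\prod_{p\in P}x_{\sigma(p)}$, the sum over all maps $\sigma:P\to\mathbb{Z}^+$ with $\sigma(x)\le\sigma(y)$ whenever $x\preceq y$; it is a quasisymmetric function. For a composition $\alpha=(\alpha_1,\dots,\alpha_k)$ of $n$ let $D(\alpha)=\{\alpha_1,\alpha_1+\alpha_2,\dots,\alpha_1+\cdots+\alpha_{k-1}\}$, and let the fundamental quasisymmetric function be $L_\alpha=\sum x_{i_1}x_{i_2}\cdots x_{i_n}$, summed over $i_1\le i_2\le\cdots\le i_n$ with $i_s<i_{s+1}$ whenever $s\in D(\alpha)$. The $L_\alpha$ form a basis of quasisymmetric functions, and $\operatorname{supp}_L(K_P(\mathbf{x}))$ is the set of compositions $\alpha$ whose coefficient in the expansion of $K_P(\mathbf{x})$ in this basis is nonzero. The shape $\operatorname{sh}(P)$ of a finite poset is the partition $\lambda$ whose conjugate $\lambda'$ satisfies $\lambda'_1+\cdots+\lambda'_i=a_i$ for all $i$, where $a_i$ is the maximum number of elements in a union of $i$ antichains of $P$ (by Greene's theorem this defines a partition of $|P|$). *)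

theory Defs
  imports Complex_Main "HOL-Library.Multiset" "HOL-Library.FuncSet" "HOL-Library.Function_Algebras"
begin

text \<open>
  A poset on \<open>A\<close> is a relation \<open>r\<close> with \<open>partial_order_on A r\<close>, where \<open>(x, y) \<in> r\<close> means
  \<open>x \<preceq> y\<close>.
\<close>

definition naturally_labeled :: "nat \<Rightarrow> nat rel \<Rightarrow> bool" where
  "naturally_labeled n P \<longleftrightarrow>
     partial_order_on {1..n} P \<and> (\<forall>x y. (x, y) \<in> P \<longrightarrow> x \<le> y)"

text \<open>
  A formal power series in \<open>x\<^sub>1, x\<^sub>2, \<dots>\<close> is given by its coefficients, and a monomial by
  the multiset of the indices of its variables, with multiplicity. Only addition and scalar
  multiplication of series are used: the multiplication that
  \<^theory>\<open>HOL-Library.Function_Algebras\<close> puts on functions is pointwise, not the product of power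
  series.
\<close>

type_synonym monomial = "nat multiset"
type_synonym series = "monomial \<Rightarrow> rat"

definition series_scale :: "rat \<Rightarrow> series \<Rightarrow> series" where
  "series_scale c f = (\<lambda>m. c * f m)"

global_interpretation series: vector_space series_scale
  by unfold_locales (simp_all add: series_scale_def fun_eq_iff algebra_simps)

text \<open>
  The formal sum \<open>\<Sum>s\<in>S. w s\<close> of the monomials \<open>w s\<close>. Below, every monomial is
  attained finitely often, as \<^const>\<open>card\<close> requires.
\<close>

definition monomial_sum :: "'s set \<Rightarrow> ('s \<Rightarrow> monomial) \<Rightarrow> series" where
  "monomial_sum S w = (\<lambda>m. of_nat (card {s \<in> S. w s = m}))"

text \<open>
  P-partitions are normalised to be \<^const>\<open>undefined\<close> off the ground set, so that each map on
  the ground set is counted once.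
\<close>

definition P_partitions :: "nat \<Rightarrow> nat rel \<Rightarrow> (nat \<Rightarrow> nat) set" where
  "P_partitions n P =
     {\<sigma> \<in> {1..n} \<rightarrow>\<^sub>E {1..}. \<forall>x y. (x, y) \<in> P \<longrightarrow> \<sigma> x \<le> \<sigma> y}"

definition P_gf :: "nat \<Rightarrow> nat rel \<Rightarrow> series" where
  "P_gf n P = monomial_sum (P_partitions n P) (\<lambda>\<sigma>. {#\<sigma> p. p \<in># mset_set {1..n}#})"

definition compositions :: "nat list set" where
  "compositions = {\<alpha>. \<forall>a \<in> set \<alpha>. 0 < a}"

definition descent_set :: "nat list \<Rightarrow> nat set" where
  "descent_set \<alpha> = {sum_list (take j \<alpha>) | j. 0 < j \<and> j < length \<alpha>}"

text \<open>
  List positions start at \<open>0\<close>, so \<open>i\<^sub>s\<close> is \<open>js ! (s - 1)\<close>.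
\<close>

definition fundamental :: "nat list \<Rightarrow> series" where
  "fundamental \<alpha> =
     monomial_sum
       {js. length js = sum_list \<alpha> \<and> (\<forall>i \<in> set js. 0 < i) \<and> sorted js \<and>
            (\<forall>s \<in> descent_set \<alpha>. js ! (s - 1) < js ! s)}
       mset"

text \<open>
  The library function \<open>representation B f b\<close> is the coefficient of \<open>b\<close> in the expansion of
  \<open>f\<close> in the linearly independent set \<open>B\<close>; here \<open>B\<close> is the set of all fundamental
  quasisymmetric functions, a basis of the quasisymmetric functions.
\<close>

definition L_coeff :: "series \<Rightarrow> nat list \<Rightarrow> rat" where
  "L_coeff f \<alpha> = series.representation (fundamental ` compositions) f (fundamental \<alpha>)"

definition supp_L :: "series \<Rightarrow> nat list set" where
  "supp_L f = {\<alpha> \<in> compositions. L_coeff f \<alpha> \<noteq> 0}"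

definition antichain :: "'a set \<Rightarrow> 'a rel \<Rightarrow> 'a set \<Rightarrow> bool" where
  "antichain A r C \<longleftrightarrow> C \<subseteq> A \<and> (\<forall>x \<in> C. \<forall>y \<in> C. (x, y) \<in> r \<longrightarrow> x = y)"

definition max_antichain_union :: "'a set \<Rightarrow> 'a rel \<Rightarrow> nat \<Rightarrow> nat" where
  "max_antichain_union A r i =
     Max {card (\<Union>j<i. C j) | C. \<forall>j<i. antichain A r (C j)}"

definition is_partition :: "nat list \<Rightarrow> bool" where
  "is_partition \<mu> \<longleftrightarrow> sorted_wrt (\<ge>) \<mu> \<and> (\<forall>p \<in> set \<mu>. 0 < p)"

definition conjugate_part :: "nat list \<Rightarrow> nat \<Rightarrow> nat" where
  "conjugate_part \<mu> i = card {j. j < length \<mu> \<and> i \<le> \<mu> ! j}"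

text \<open>
  The partition described below is unique, since it is determined by its conjugate; it exists
  by Greene's theorem.
\<close>

definition shape :: "'a set \<Rightarrow> 'a rel \<Rightarrow> nat list" where
  "shape A r = (THE \<mu>. is_partition \<mu> \<and>
     (\<forall>i. (\<Sum>j=1..i. conjugate_part \<mu> j) = max_antichain_union A r i))"

end

theory Submission
  imports Defs
begin

text \<open>
  By Stanley's expansion, \<open>K\<^sub>P\<close> is the sum of \<open>L\<^sub>\<alpha>\<close> over the descent compositions \<open>\<alpha>\<close> of the
  linear extensions of \<open>P\<close>, so the support records exactly which descent sets occur. In a naturally
  labeled poset, a run of consecutive descents of a linear extension is an antichain. Conversely,
  let \<open>S\<close> be a union of \<open>i\<close> antichains and let \<open>h x\<close> be the size of a longest chain of \<open>S\<close> below
  \<open>x\<close>. Listing the poset level by level of \<open>h\<close>, in each level first the elements of \<open>S\<close> in decreasing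
  order and then the others in increasing order, gives a linear extension in which \<open>S\<close> is
  covered by \<open>i\<close> runs of descents. Any poset having a linear extension with the same descent set
  therefore has \<open>i\<close> antichains with a union of the same size.
\<close>

section \<open>Compositions and descent sets\<close>

lemma descent_set_Nil [simp]: "descent_set [] = {}"
  by (simp add: descent_set_def)

lemma descent_set_singleton [simp]: "descent_set [a] = {}"
  by (auto simp: descent_set_def)

text \<open>Compositions are handled by induction from the right, and this is the recursion step.
  The empty prefix is separate because its total 0 is not a descent.\<close>

lemma descent_set_snoc:
  "descent_set (\<alpha> @ [a]) = (if \<alpha> = [] then {} else insert (sum_list \<alpha>) (descent_set \<alpha>))"
proof (cases "\<alpha> = []")
  case False
  have "descent_set (\<alpha> @ [a]) = (\<lambda>j. sum_list (take j (\<alpha> @ [a]))) ` {j. 0 < j \<and> j < Suc (length \<alpha>)}"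
    by (simp only: descent_set_def setcompr_eq_image length_append_singleton)
  also have "{j. 0 < j \<and> j < Suc (length \<alpha>)} = insert (length \<alpha>) {j. 0 < j \<and> j < length \<alpha>}"
    using False by (auto simp: less_Suc_eq)
  also have "(\<lambda>j. sum_list (take j (\<alpha> @ [a]))) ` \<dots> = insert (sum_list \<alpha>) (descent_set \<alpha>)"
    by (auto simp: descent_set_def)
  finally show ?thesis using False by simp
qed (simp add: descent_set_def)

lemma descent_set_bounds:
  "\<alpha> \<in> compositions \<Longrightarrow> descent_set \<alpha> \<subseteq> {1..<sum_list \<alpha>}"
proof (induction \<alpha> rule: rev_induct)
  case (snoc a \<alpha>)
  then have "\<alpha> \<in> compositions" "0 < a" by (auto simp: compositions_def)
  moreover have "0 < sum_list \<alpha>" if "\<alpha> \<noteq> []"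
    using that \<open>\<alpha> \<in> compositions\<close> by (cases \<alpha>) (auto simp: compositions_def)
  ultimately show ?case using snoc.IH by (auto simp: descent_set_snoc)
qed simp

lemma finite_descent_set: "\<alpha> \<in> compositions \<Longrightarrow> finite (descent_set \<alpha>)"
  using descent_set_bounds finite_subset by blast

text \<open>The last proper partial sum is the largest one, so the descent set shows where the last
  part starts. The inserted 0 covers a single part, where there are no descents.\<close>

lemma sum_list_prefix_eq_Max:
  assumes "\<alpha> @ [a] \<in> compositions"
  shows "sum_list \<alpha> = Max (insert 0 (descent_set (\<alpha> @ [a])))"
proof (cases "\<alpha> = []")
  case False
  have "\<alpha> \<in> compositions" using assms by (auto simp: compositions_def)
  then have "descent_set \<alpha> \<subseteq> {1..<sum_list \<alpha>}" "finite (descent_set \<alpha>)"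
    by (fact descent_set_bounds finite_descent_set)+
  with False show ?thesis
    by (intro sym[OF Max_eqI]) (auto simp: descent_set_snoc)
qed simp

lemma composition_eqI:
  assumes "\<alpha> \<in> compositions" "\<beta> \<in> compositions"
    and "sum_list \<alpha> = sum_list \<beta>" "descent_set \<alpha> = descent_set \<beta>"
  shows "\<alpha> = \<beta>"
  using assms
proof (induction \<alpha> arbitrary: \<beta> rule: rev_induct)
  case Nil
  then show ?case by (cases \<beta>) (auto simp: compositions_def)
next
  case (snoc a \<alpha>)
  then obtain b \<beta>' where \<beta>: "\<beta> = \<beta>' @ [b]"
    by (cases \<beta> rule: rev_cases) (auto simp: compositions_def)
  have c: "\<alpha> \<in> compositions" "\<beta>' \<in> compositions"
    using snoc.prems \<beta> by (auto simp: compositions_def)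
  have s: "sum_list \<alpha> = sum_list \<beta>'"
    using snoc.prems \<beta> sum_list_prefix_eq_Max[of \<alpha> a] sum_list_prefix_eq_Max[of \<beta>' b] by simp
  \<comment> \<open>Descents of \<gamma> lie strictly below its total, so deleting the total exactly
    undoes the appending of a part.\<close>
  have "descent_set \<gamma> = descent_set (\<gamma> @ [x]) - {sum_list \<gamma>}" if "\<gamma> \<in> compositions" for \<gamma> x
    using descent_set_bounds[OF that] by (auto simp: descent_set_snoc)
  then have "descent_set \<alpha> = descent_set \<beta>'"
    using c s snoc.prems \<beta> by metis
  with snoc.IH c s have "\<alpha> = \<beta>'" by blast
  with snoc.prems \<beta> show ?case by simp
qed

lemma composition_exists:
  assumes "D \<subseteq> {1..<n}"
  shows "\<exists>\<alpha> \<in> compositions. sum_list \<alpha> = n \<and> descent_set \<alpha> = D"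
  using assms
proof (induction n arbitrary: D)
  case 0
  then show ?case by (intro bexI[of _ "[]"]) (auto simp: compositions_def)
next
  case (Suc n)
  have "D - {n} \<subseteq> {1..<n}" using Suc.prems by auto
  with Suc.IH obtain \<alpha> where
    \<alpha>: "\<alpha> \<in> compositions" "sum_list \<alpha> = n" "descent_set \<alpha> = D - {n}" by metis
  show ?case
  \<comment> \<open>A break at \<open>n\<close>, or the very first unit, starts a new part of size
    1; otherwise the last part grows by 1.\<close>
  proof (cases "n = 0 \<or> n \<in> D")
    case True
    have "\<alpha> = []" if "n = 0" using \<alpha>(1,2) that by (cases \<alpha>) (auto simp: compositions_def)
    moreover have "\<alpha> \<noteq> []" if "n \<noteq> 0" using \<alpha>(2) that by auto
    moreover have "D = {}" if "n = 0" using Suc.prems that by auto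
    ultimately have "descent_set (\<alpha> @ [1]) = D"
      using \<alpha> True by (cases "n = 0") (auto simp: descent_set_snoc)
    then show ?thesis
      using \<alpha>(1,2) by (intro bexI[of _ "\<alpha> @ [1]"]) (auto simp: compositions_def)
  next
    case False
    with \<alpha>(2) obtain a \<beta> where \<beta>: "\<alpha> = \<beta> @ [a]"
      by (cases \<alpha> rule: rev_cases) auto
    have "descent_set (\<beta> @ [Suc a]) = D"
      using \<alpha> \<beta> False by (simp add: descent_set_snoc)
    then show ?thesis
      using \<alpha>(1,2) \<beta> by (intro bexI[of _ "\<beta> @ [Suc a]"]) (auto simp: compositions_def)
  qed
qed

section \<open>Linear independence of the fundamental quasisymmetric functions\<close>

text \<open>A multiset has a single weakly increasing arrangement, so at most one word contributes
  to each monomial.\<close>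

lemma fundamental_apply:
  "fundamental \<alpha> m =
     of_bool (size m = sum_list \<alpha> \<and> 0 \<notin># m \<and>
       (\<forall>s \<in> descent_set \<alpha>. sorted_list_of_multiset m ! (s - 1) < sorted_list_of_multiset m ! s))"
  (is "_ = of_bool ?R")
proof -
  let ?T = "{js \<in> {js. length js = sum_list \<alpha> \<and> (\<forall>i \<in> set js. 0 < i) \<and> sorted js \<and>
            (\<forall>s \<in> descent_set \<alpha>. js ! (s - 1) < js ! s)}. mset js = m}"
  have eq: "js = sorted_list_of_multiset m" if "sorted js" "mset js = m" for js
    using that by (metis sorted_list_of_multiset_mset sorted_sort_id)
  have "?T = (if ?R then {sorted_list_of_multiset m} else {})"
  proof (cases ?R)
    case True
    have len: "length (sorted_list_of_multiset m) = sum_list \<alpha>"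
      using True by (metis mset_sorted_list_of_multiset size_mset)
    have pos: "\<forall>i \<in> set (sorted_list_of_multiset m). 0 < i"
      using True by (metis gr0I set_sorted_list_of_multiset)
    show ?thesis
      using True len pos eq by (auto simp: sorted_sorted_list_of_multiset)
  next
    case False
    show ?thesis
      unfolding if_not_P[OF False]
    proof (rule ccontr)
      assume "?T \<noteq> {}"
      then obtain js where js: "js \<in> ?T" by blast
      then have "js = sorted_list_of_multiset m" using eq by blast
      with js have ?R by (auto simp flip: size_mset)
      with False show False by contradiction
    qed
  qed
  then show ?thesis by (simp add: fundamental_def monomial_sum_def)
qed

text \<open>The coarsest monomial of \<open>L\<^sub>\<alpha>\<close>, whose indices increase at the positions in \<open>D(\<alpha>)\<close> only.\<close>

definition leading_word :: "nat list \<Rightarrow> nat list" where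
  "leading_word \<alpha> = map (\<lambda>s. Suc (card {d \<in> descent_set \<alpha>. d \<le> s})) [0..<sum_list \<alpha>]"

text \<open>This is unitriangularity with respect to inclusion of descent sets: the leading word of
  \<alpha> rises exactly at D(\<alpha>), and \<beta> requires rises at D(\<beta>).\<close>

lemma fundamental_leading_word:
  assumes \<alpha>: "\<alpha> \<in> compositions" and \<beta>: "\<beta> \<in> compositions"
  shows "fundamental \<beta> (mset (leading_word \<alpha>)) =
    of_bool (sum_list \<beta> = sum_list \<alpha> \<and> descent_set \<beta> \<subseteq> descent_set \<alpha>)"
proof -
  let ?w = "leading_word \<alpha>"
  let ?f = "\<lambda>s. card {d \<in> descent_set \<alpha>. d \<le> s}"
  have fin: "finite (descent_set \<alpha>)" using \<alpha> by (rule finite_descent_set)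
  have mono: "?f s \<le> ?f t" if "s \<le> t" for s t
    using that fin by (intro card_mono) auto
  have sorted: "sorted ?w"
    unfolding leading_word_def sorted_iff_nth_mono by (auto intro!: mono)
  have step: "?w ! (s - 1) < ?w ! s \<longleftrightarrow> s \<in> descent_set \<alpha>" if "s \<in> {1..<sum_list \<alpha>}" for s
  proof -
    have "d \<le> s \<longleftrightarrow> d = s \<or> d \<le> s - 1" for d using that by auto
    then have "{d \<in> descent_set \<alpha>. d \<le> s} =
        (if s \<in> descent_set \<alpha> then insert s else id) {d \<in> descent_set \<alpha>. d \<le> s - 1}"
      by auto
    moreover have "s \<notin> {d \<in> descent_set \<alpha>. d \<le> s - 1}" using that by auto
    ultimately have "?f s = ?f (s - 1) + of_bool (s \<in> descent_set \<alpha>)"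
      using fin by (simp split: if_splits)
    moreover have "s - 1 < sum_list \<alpha>" "s < sum_list \<alpha>" using that by auto
    ultimately show ?thesis by (simp add: leading_word_def)
  qed
  have "sorted_list_of_multiset (mset ?w) = ?w"
    using sorted by (metis sorted_list_of_multiset_mset sorted_sort_id)
  moreover have "size (mset ?w) = sum_list \<alpha>" "0 \<notin># mset ?w"
    by (auto simp: leading_word_def)
  moreover have "(\<forall>s \<in> descent_set \<beta>. ?w ! (s - 1) < ?w ! s) \<longleftrightarrow> descent_set \<beta> \<subseteq> descent_set \<alpha>"
    if "sum_list \<beta> = sum_list \<alpha>"
    using step descent_set_bounds[OF \<beta>] that by (auto simp: subset_iff)
  ultimately show ?thesis unfolding fundamental_apply by auto
qed

text \<open>Evaluating each function at the leading monomial of the other yields both inclusions of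
  descent sets.\<close>

lemma inj_on_fundamental: "inj_on fundamental compositions"
proof (rule inj_onI)
  fix \<alpha> \<beta> assume *: "\<alpha> \<in> compositions" "\<beta> \<in> compositions" "fundamental \<alpha> = fundamental \<beta>"
  have "fundamental \<beta> (mset (leading_word \<alpha>)) = 1" "fundamental \<alpha> (mset (leading_word \<beta>)) = 1"
    using fundamental_leading_word[of \<alpha> \<alpha>] fundamental_leading_word[of \<beta> \<beta>] * by auto
  then show "\<alpha> = \<beta>"
    using fundamental_leading_word[of \<alpha> \<beta>] fundamental_leading_word[of \<beta> \<alpha>] *
    by (intro composition_eqI) (auto simp: of_bool_def split: if_splits)
qed

lemma series_sum_apply: "(\<Sum>i\<in>I. (f i :: series)) m = (\<Sum>i\<in>I. f i m)"
  by (induction I rule: infinite_finite_induct) auto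

lemma independent_fundamental: "series.independent (fundamental ` compositions)"
proof
  assume "series.dependent (fundamental ` compositions)"
  then obtain T u where T: "finite T" "T \<subseteq> fundamental ` compositions"
      and zero: "(\<Sum>v\<in>T. series_scale (u v) v) = 0" and "\<exists>v\<in>T. u v \<noteq> 0"
    unfolding series.dependent_explicit by blast
  then have "\<exists>\<alpha>. \<alpha> \<in> compositions \<and> fundamental \<alpha> \<in> T \<and> u (fundamental \<alpha>) \<noteq> 0" by blast
  \<comment> \<open>Among the terms with nonzero coefficient, one with the fewest descents is
    chosen; by triangularity no other such term contains its leading monomial.\<close>
  then obtain \<alpha> where \<alpha>: "\<alpha> \<in> compositions" "fundamental \<alpha> \<in> T" "u (fundamental \<alpha>) \<noteq> 0"
    and min: "\<And>\<beta>. \<beta> \<in> compositions \<Longrightarrow> fundamental \<beta> \<in> T \<Longrightarrow> u (fundamental \<beta>) \<noteq> 0 \<Longrightarrow>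
       card (descent_set \<alpha>) \<le> card (descent_set \<beta>)"
    using exists_least_iff[of "\<lambda>k. \<exists>\<alpha>. \<alpha> \<in> compositions \<and> fundamental \<alpha> \<in> T \<and>
        u (fundamental \<alpha>) \<noteq> 0 \<and> card (descent_set \<alpha>) = k"]
    by (metis not_le)
  let ?m = "mset (leading_word \<alpha>)"
  have "u v * v ?m = (if v = fundamental \<alpha> then u v else 0)" if "v \<in> T" for v
  proof -
    obtain \<beta> where \<beta>: "\<beta> \<in> compositions" "v = fundamental \<beta>" using \<open>v \<in> T\<close> T by blast
    show ?thesis
    proof (cases "u v = 0 \<or> v ?m = 0")
      case True
      then show ?thesis using \<beta> \<alpha> fundamental_leading_word[of \<alpha> \<alpha>] by auto
    next
      case False
      then have *: "sum_list \<beta> = sum_list \<alpha>" "descent_set \<beta> \<subseteq> descent_set \<alpha>"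
        using \<alpha> \<beta> by (auto simp: fundamental_leading_word)
      moreover have "card (descent_set \<alpha>) \<le> card (descent_set \<beta>)"
        using False \<beta> that by (intro min) auto
      ultimately have "descent_set \<beta> = descent_set \<alpha>"
        using finite_descent_set[OF \<alpha>(1)] by (metis card_seteq)
      with * \<alpha> \<beta> have "\<beta> = \<alpha>" by (intro composition_eqI) auto
      then show ?thesis using \<alpha> \<beta> by (simp add: fundamental_leading_word)
    qed
  qed
  then have "(\<Sum>v\<in>T. series_scale (u v) v) ?m = u (fundamental \<alpha>)"
    using T(1) \<alpha>(2) by (simp add: series_sum_apply series_scale_def)
  with zero \<alpha>(3) show False by simp
qed

section \<open>Linear extensions\<close>

definition linear_extensions :: "nat \<Rightarrow> nat rel \<Rightarrow> nat list set" where
  "linear_extensions n P =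
     {w. distinct w \<and> set w = {1..n} \<and> (\<forall>p q. p < q \<and> q < n \<longrightarrow> (w ! q, w ! p) \<notin> P)}"

text \<open>The index \<open>s\<close> compares the letters numbered \<open>s\<close> and
  \<open>s + 1\<close> when counting from 1, the convention of \<open>descent_set\<close>.\<close>

definition descents :: "nat list \<Rightarrow> nat set" where
  "descents w = {s. 0 < s \<and> s < length w \<and> w ! s < w ! (s - 1)}"

lemma length_linear_extension: "w \<in> linear_extensions n P \<Longrightarrow> length w = n"
  by (metis (mono_tags, lifting) card_atLeastAtMost diff_Suc_1 distinct_card linear_extensions_def
      mem_Collect_eq)

lemma finite_linear_extensions: "finite (linear_extensions n P)"
proof (rule finite_subset)
  show "linear_extensions n P \<subseteq> {w. set w \<subseteq> {1..n} \<and> length w = n}"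
    using length_linear_extension by (auto simp: linear_extensions_def)
qed (simp add: finite_lists_length_eq)

lemma descents_run_decreasing:
  assumes "p < q" "\<And>s. p < s \<Longrightarrow> s \<le> q \<Longrightarrow> s \<in> descents w"
  shows "w ! q < w ! p"
  using assms
proof (induction q)
  case (Suc q)
  have "w ! Suc q < w ! q" using Suc.prems(2)[of "Suc q"] Suc.prems(1) by (simp add: descents_def)
  moreover have "w ! q < w ! p" if "p \<noteq> q"
    using Suc.IH Suc.prems that by auto
  ultimately show ?case by (cases "p = q") auto
qed simp

lemma no_descents_increasing:
  assumes "p < q" "q < length w" "distinct w" "\<And>s. p < s \<Longrightarrow> s \<le> q \<Longrightarrow> s \<notin> descents w"
  shows "w ! p < w ! q"
  using assms
proof (induction q)
  case (Suc q)
  have "w ! q \<noteq> w ! Suc q" using Suc.prems by (simp add: nth_eq_iff_index_eq)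
  moreover have "\<not> w ! Suc q < w ! q"
    using Suc.prems(4)[of "Suc q"] Suc.prems(1,2) by (simp add: descents_def)
  moreover have "w ! p < w ! q" if "p \<noteq> q"
    using Suc.IH Suc.prems that by auto
  ultimately show ?case by (cases "p = q") auto
qed simp

text \<open>For values of \<open>b\<close> at most \<open>n\<close> this encodes the lexicographic order on the pairs \<open>(a x, b x)\<close>.\<close>

definition lex_key :: "nat \<Rightarrow> ('a \<Rightarrow> nat) \<Rightarrow> ('a \<Rightarrow> nat) \<Rightarrow> 'a \<Rightarrow> nat" where
  "lex_key n a b x = a x * Suc n + b x"

lemma lex_key_less_iff:
  assumes "b x \<le> n" "b y \<le> n"
  shows "lex_key n a b x < lex_key n a b y \<longleftrightarrow> a x < a y \<or> a x = a y \<and> b x < b y"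
proof -
  \<comment> \<open>One unit of \<open>a\<close> is worth \<open>Suc n\<close>, which exceeds every
    admissible value of \<open>b\<close>.\<close>
  have "lex_key n a b u < lex_key n a b v" if "a u < a v" "b u \<le> n" for u v
  proof -
    have "lex_key n a b u < Suc (a u) * Suc n" using that by (simp add: lex_key_def)
    also have "\<dots> \<le> a v * Suc n" using that by (intro mult_le_mono1) simp
    finally show ?thesis by (simp add: lex_key_def)
  qed
  from this[of x y] this[of y x] show ?thesis
    using assms by (cases "a x" "a y" rule: linorder_cases) (auto simp: lex_key_def)
qed

lemma sort_key_inj:
  fixes n :: nat and K :: "nat \<Rightarrow> nat"
  assumes "inj_on K {1..n}"
  defines "w \<equiv> sort_key K [1..<Suc n]"
  shows "distinct w" "set w = {1..n}" "length w = n"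
    "\<And>p q. p < q \<Longrightarrow> q < n \<Longrightarrow> K (w ! p) < K (w ! q)"
proof -
  show w: "distinct w" "set w = {1..n}" "length w = n" by (auto simp: w_def)
  have "sorted_wrt (<) (map K w)"
    unfolding strict_sorted_iff using assms(1) w by (auto simp: w_def distinct_map)
  then show "K (w ! p) < K (w ! q)" if "p < q" "q < n" for p q
    using that w by (simp add: sorted_wrt_iff_nth_less)
qed

text \<open>Used to recognise a given word as the outcome of sorting: both key lists are strictly
  increasing with the same set of entries, hence equal, and \<open>K\<close> is injective.\<close>

lemma sort_key_inj_unique:
  fixes n :: nat and K :: "nat \<Rightarrow> nat"
  assumes "inj_on K {1..n}" "distinct w" "set w = {1..n}"
    and "\<And>p q. p < q \<Longrightarrow> q < length w \<Longrightarrow> K (w ! p) < K (w ! q)"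
  shows "sort_key K [1..<Suc n] = w"
proof -
  let ?v = "sort_key K [1..<Suc n]"
  have "set ?v = {1..n}" by auto
  have "sorted_wrt (<) (map K w)" using assms(4) by (simp add: sorted_wrt_iff_nth_less)
  moreover have "sorted (map K ?v)" "distinct (map K ?v)"
    using assms(1) \<open>set ?v = {1..n}\<close> by (auto simp: distinct_map)
  moreover have "set (map K w) = set (map K ?v)" using assms(3) \<open>set ?v = {1..n}\<close> by simp
  ultimately have "map K ?v = map K w"
    by (metis sorted_distinct_set_unique strict_sorted_iff)
  moreover have "inj_on K (set ?v \<union> set w)"
    by (simp only: assms(1,3) \<open>set ?v = {1..n}\<close> Un_absorb)
  ultimately show ?thesis by (rule map_inj_on)
qed

section \<open>Expansion of the generating function\<close>

text \<open>
  Stanley's bijection: a \<open>P\<close>-partition \<open>\<sigma>\<close> goes to the linear extension that lists the elements by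
  increasing \<open>\<sigma>\<close>, ties being broken by the labels.
\<close>

lemma P_partitions_bij_linear_extensions:
  fixes n :: nat and P :: "nat rel" and m :: monomial
  assumes P: "naturally_labeled n P" and m: "size m = n" "0 \<notin># m"
  defines "js \<equiv> sorted_list_of_multiset m"
  shows "bij_betw (\<lambda>\<sigma>. sort_key (lex_key n \<sigma> id) [1..<Suc n])
     {\<sigma> \<in> P_partitions n P. image_mset \<sigma> (mset_set {1..n}) = m}
     {w \<in> linear_extensions n P. \<forall>s \<in> descents w. js ! (s - 1) < js ! s}"
    (is "bij_betw _ ?A ?B")
proof -
  define F where "F = (\<lambda>\<sigma>. sort_key (lex_key n \<sigma> id) [1..<Suc n])"
  have nat_lab: "x \<le> y" if "(x, y) \<in> P" for x y
    using P that by (simp add: naturally_labeled_def)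
  have PD: "x \<in> {1..n}" "y \<in> {1..n}" if "(x, y) \<in> P" for x y
    using P that by (auto simp: naturally_labeled_def partial_order_on_def preorder_on_def refl_on_def)
  have js: "sorted js" "mset js = m" "length js = n"
    using m by (auto simp: js_def sorted_sorted_list_of_multiset simp flip: size_mset)
  have less: "lex_key n \<sigma> id x < lex_key n \<sigma> id y \<longleftrightarrow> \<sigma> x < \<sigma> y \<or> \<sigma> x = \<sigma> y \<and> x < y"
    if "x \<in> {1..n}" "y \<in> {1..n}" for \<sigma> x y
    using that lex_key_less_iff[of id x n y \<sigma>] by simp
  have inj: "inj_on (lex_key n \<sigma> id) {1..n}" for \<sigma>
    by (rule inj_onI) (metis less less_irrefl linorder_neqE_nat)
  have F: "distinct (F \<sigma>)" "set (F \<sigma>) = {1..n}" "length (F \<sigma>) = n"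
      "\<And>p q. p < q \<Longrightarrow> q < n \<Longrightarrow> \<sigma> (F \<sigma> ! p) < \<sigma> (F \<sigma> ! q) \<or>
         \<sigma> (F \<sigma> ! p) = \<sigma> (F \<sigma> ! q) \<and> F \<sigma> ! p < F \<sigma> ! q" for \<sigma>
  proof -
    have F_eq: "F \<sigma> = sort_key (lex_key n \<sigma> id) [1..<Suc n]" by (simp only: F_def)
    note F' = sort_key_inj[OF inj[of \<sigma>], folded F_eq]
    show 1: "distinct (F \<sigma>)" "set (F \<sigma>) = {1..n}" "length (F \<sigma>) = n" by (fact F')+
    fix p q assume "p < q" "q < n"
    moreover from this have "F \<sigma> ! p \<in> {1..n}" "F \<sigma> ! q \<in> {1..n}"
      using 1 by (metis less_trans nth_mem)+
    ultimately show "\<sigma> (F \<sigma> ! p) < \<sigma> (F \<sigma> ! q) \<or>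
         \<sigma> (F \<sigma> ! p) = \<sigma> (F \<sigma> ! q) \<and> F \<sigma> ! p < F \<sigma> ! q"
      using F'(4) less by blast
  qed
  \<comment> \<open>Read along \<open>F \<sigma>\<close>, the values of \<sigma> are sorted and have
    content \<open>m\<close>, so they form the fixed word \<open>js\<close>. Thus
    \<open>F \<sigma>\<close> determines \<sigma>.\<close>
  have map_F: "map \<sigma> (F \<sigma>) = js" if "\<sigma> \<in> ?A" for \<sigma>
  proof -
    have "sorted (map \<sigma> (F \<sigma>))"
      using F(3)[of \<sigma>] F(4)[of _ _ \<sigma>] by (force simp: sorted_wrt_iff_nth_less less_imp_le)
    moreover have "mset (map \<sigma> (F \<sigma>)) = m"
    proof -
      have "mset (F \<sigma>) = mset_set {1..n}"
        using F(1,2)[of \<sigma>] by (metis mset_set_set)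
      with that show ?thesis by simp
    qed
    ultimately show ?thesis
      using js by (metis sorted_list_of_multiset_mset sorted_sort_id)
  qed
  then have nth_F: "\<sigma> (F \<sigma> ! p) = js ! p" if "\<sigma> \<in> ?A" "p < n" for \<sigma> p
    using that nth_map[of p "F \<sigma>" \<sigma>] F(3)[of \<sigma>] by simp
  have "inj_on F ?A"
  proof (rule inj_onI)
    fix \<sigma> \<tau> assume *: "\<sigma> \<in> ?A" "\<tau> \<in> ?A" "F \<sigma> = F \<tau>"
    show "\<sigma> = \<tau>"
    proof (rule PiE_ext)
      show "\<sigma> \<in> {1..n} \<rightarrow>\<^sub>E {1..}" "\<tau> \<in> {1..n} \<rightarrow>\<^sub>E {1..}" using * by (auto simp: P_partitions_def)
      fix x assume "x \<in> {1..n}"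
      then obtain p where "p < n" "x = F \<sigma> ! p" using F(2,3)[of \<sigma>] by (metis in_set_conv_nth)
      then show "\<sigma> x = \<tau> x" using nth_F * by metis
    qed
  qed
  moreover have "F \<sigma> \<in> ?B" if "\<sigma> \<in> ?A" for \<sigma>
  proof -
    have "(F \<sigma> ! q, F \<sigma> ! p) \<notin> P" if "p < q" "q < n" for p q
    proof
      assume *: "(F \<sigma> ! q, F \<sigma> ! p) \<in> P"
      then have "\<sigma> (F \<sigma> ! q) \<le> \<sigma> (F \<sigma> ! p)"
        using \<open>\<sigma> \<in> ?A\<close> by (auto simp: P_partitions_def)
      \<comment> \<open>Both \<sigma> and the labels weakly increase along \<open>P\<close>, so
        breaking ties by labels respects the order.\<close>
      with nat_lab[OF *] F(4)[OF that, of \<sigma>] show False by linarith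
    qed
    then have "F \<sigma> \<in> linear_extensions n P" using F(1,2) by (simp add: linear_extensions_def)
    moreover have "js ! (s - 1) < js ! s" if s: "s \<in> descents (F \<sigma>)" for s
    proof -
      have *: "0 < s" "s < n" "F \<sigma> ! s < F \<sigma> ! (s - 1)"
        using s F(3)[of \<sigma>] by (auto simp: descents_def)
      \<comment> \<open>Equal values would have been listed with increasing labels, so \<sigma> must
        rise strictly at a descent.\<close>
      then have "\<sigma> (F \<sigma> ! (s - 1)) < \<sigma> (F \<sigma> ! s)"
        using F(4)[of "s - 1" s \<sigma>] by linarith
      then show ?thesis using nth_F \<open>\<sigma> \<in> ?A\<close> * by simp
    qed
    ultimately show ?thesis by blast
  qed
  moreover have "\<exists>\<sigma> \<in> ?A. F \<sigma> = w" if "w \<in> ?B" for w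
  proof -
    have w: "distinct w" "set w = {1..n}" "length w = n"
      "\<And>p q. p < q \<Longrightarrow> q < n \<Longrightarrow> (w ! q, w ! p) \<notin> P"
      "\<And>s. s \<in> descents w \<Longrightarrow> js ! (s - 1) < js ! s"
      using that length_linear_extension by (auto simp: linear_extensions_def)
    \<comment> \<open>The inverse map gives the letter at position \<open>p\<close> the value
      \<open>js ! p\<close>; \<open>restrict\<close> supplies \<open>undefined\<close> off the
      ground set.\<close>
    define \<sigma> where "\<sigma> = restrict (\<lambda>x. js ! (THE p. p < n \<and> w ! p = x)) {1..n}"
    have \<sigma>: "\<sigma> (w ! p) = js ! p" if "p < n" for p
    proof -
      have "(THE q. q < n \<and> w ! q = w ! p) = p"
        using that w by (intro the_equality) (auto simp: nth_eq_iff_index_eq)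
      moreover have "w ! p \<in> {1..n}" using that w by (metis nth_mem)
      ultimately show ?thesis by (simp add: \<sigma>_def)
    qed
    have index: "\<exists>p<n. x = w ! p" if "x \<in> {1..n}" for x
      using that w by (metis in_set_conv_nth)
    have pos: "0 < js ! p" if "p < n" for p
      using that m js by (metis gr0I nth_mem set_mset_mset)
    have mono: "js ! p \<le> js ! q" if "p \<le> q" "q < n" for p q
      using that js by (simp add: sorted_nth_mono)
    have "\<sigma> x \<le> \<sigma> y" if xy: "(x, y) \<in> P" for x y
    proof -
      obtain p q where "p < n" "q < n" "x = w ! p" "y = w ! q"
        using PD[OF xy] index by metis
      moreover from this have "p \<le> q" using xy w(4) by (metis not_le)
      ultimately show ?thesis using \<sigma> mono by simp
    qed
    moreover have "\<sigma> \<in> {1..n} \<rightarrow>\<^sub>E {1..}"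
    proof (rule PiE_I)
      fix x assume "x \<in> {1..n}"
      then show "\<sigma> x \<in> {1..}" using index \<sigma> pos by (metis Suc_leI atLeast_iff One_nat_def)
    qed (auto simp: \<sigma>_def)
    ultimately have "\<sigma> \<in> P_partitions n P" by (simp add: P_partitions_def)
    moreover have "image_mset \<sigma> (mset_set {1..n}) = m"
    proof -
      have "map \<sigma> w = js" using w(3) js(3) \<sigma> by (simp add: list_eq_iff_nth_eq)
      moreover have "mset_set {1..n} = mset w" using w by (metis mset_set_set)
      ultimately show ?thesis using js(2) by (metis mset_map)
    qed
    moreover have "F \<sigma> = w"
      unfolding F_def
    proof (rule sort_key_inj_unique[OF inj w(1,2)])
      fix p q assume pq: "p < q" "q < length w"
      \<comment> \<open>On a stretch where \<open>js\<close> is constant there can be no descent of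
        \<open>w\<close>, so the labels increase as the tie-breaking rule demands.\<close>
      have "w ! p < w ! q" if eq: "js ! p = js ! q"
      proof (rule no_descents_increasing[OF pq w(1)])
        fix s assume s: "p < s" "s \<le> q"
        show "s \<notin> descents w"
        proof
          assume "s \<in> descents w"
          then have "js ! (s - 1) < js ! s" by (rule w(5))
          moreover have "js ! p \<le> js ! (s - 1)" "js ! s \<le> js ! q"
            using s pq w(3) by (auto intro!: mono)
          ultimately show False using eq by linarith
        qed
      qed
      moreover have "js ! p \<le> js ! q" using pq w(3) by (auto intro!: mono)
      moreover have "w ! p \<in> {1..n}" "w ! q \<in> {1..n}" using pq w(2) by (metis less_trans nth_mem)+
      ultimately show "lex_key n \<sigma> id (w ! p) < lex_key n \<sigma> id (w ! q)"
        using less \<sigma> pq w(3) by (metis le_neq_implies_less less_trans)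
    qed
    ultimately show ?thesis by blast
  qed
  ultimately have "bij_betw F ?A ?B" unfolding bij_betw_def by blast
  then show ?thesis unfolding F_def .
qed

text \<open>The choice is in fact forced, by \<open>composition_eqI\<close>.\<close>

definition descent_composition :: "nat list \<Rightarrow> nat list" where
  "descent_composition w =
     (SOME \<alpha>. \<alpha> \<in> compositions \<and> sum_list \<alpha> = length w \<and> descent_set \<alpha> = descents w)"

lemma descent_composition:
  "descent_composition w \<in> compositions" "sum_list (descent_composition w) = length w"
  "descent_set (descent_composition w) = descents w"
proof -
  have "descents w \<subseteq> {1..<length w}" by (auto simp: descents_def)
  from someI_ex[OF composition_exists[OF this, unfolded Bex_def]]
  show "descent_composition w \<in> compositions" "sum_list (descent_composition w) = length w"
    "descent_set (descent_composition w) = descents w"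
    by (simp_all add: descent_composition_def)
qed

text \<open>Coefficients are compared at each monomial: Stanley's bijection counts the linear
  extensions whose descents are strict rises of the sorted monomial, and these are the ones whose
  fundamental function contains it.\<close>

lemma P_gf_eq_sum_fundamental:
  assumes "naturally_labeled n P"
  shows "P_gf n P = (\<Sum>w \<in> linear_extensions n P. fundamental (descent_composition w))"
proof
  fix m :: monomial
  let ?js = "sorted_list_of_multiset m"
  let ?A = "{\<sigma> \<in> P_partitions n P. image_mset \<sigma> (mset_set {1..n}) = m}"
  let ?R = "\<lambda>w. size m = n \<and> 0 \<notin># m \<and> (\<forall>s \<in> descents w. ?js ! (s - 1) < ?js ! s)"
  have "card ?A = card {w \<in> linear_extensions n P. ?R w}"
  proof (cases "size m = n \<and> 0 \<notin># m")
    case True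
    then show ?thesis
      using bij_betw_same_card[OF P_partitions_bij_linear_extensions[OF assms]] by simp
  next
    case False
    \<comment> \<open>A \<open>P\<close>-partition takes \<open>n\<close> positive values, so on all
      other monomials both counts vanish.\<close>
    have "size m = n \<and> 0 \<notin># m" if "\<sigma> \<in> ?A" for \<sigma>
      using that by (fastforce simp: P_partitions_def PiE_iff)
    with False have "?A = {}" by blast
    moreover have "{w \<in> linear_extensions n P. ?R w} = {}" using False by blast
    ultimately show ?thesis by (simp only: card.empty)
  qed
  also have "rat_of_nat \<dots> = (\<Sum>w \<in> linear_extensions n P. of_bool (?R w))"
    using finite_linear_extensions by (simp add: sum.If_cases of_bool_def Int_def)
  also have "\<dots> = (\<Sum>w \<in> linear_extensions n P. fundamental (descent_composition w) m)"
    by (intro sum.cong refl)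
      (simp add: fundamental_apply descent_composition length_linear_extension)
  finally show "P_gf n P m = (\<Sum>w \<in> linear_extensions n P. fundamental (descent_composition w)) m"
    by (simp add: P_gf_def monomial_sum_def series_sum_apply)
qed

text \<open>Each coefficient counts linear extensions, so nothing cancels and it is nonzero as soon
  as one exists.\<close>

lemma supp_L_P_gf:
  assumes "naturally_labeled n P"
  shows "supp_L (P_gf n P) = descent_composition ` linear_extensions n P"
proof -
  let ?B = "fundamental ` compositions"
  let ?L = "linear_extensions n P"
  have coeff: "L_coeff (P_gf n P) \<alpha> = of_nat (card {w \<in> ?L. descent_composition w = \<alpha>})"
    if \<alpha>: "\<alpha> \<in> compositions" for \<alpha>
  proof -
    have "L_coeff (P_gf n P) \<alpha> =
        (\<Sum>w\<in>?L. series.representation ?B (fundamental (descent_composition w)) (fundamental \<alpha>))"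
      unfolding L_coeff_def P_gf_eq_sum_fundamental[OF assms]
      by (subst series.representation_sum)
        (auto simp: independent_fundamental descent_composition intro!: series.span_base)
    also have "\<dots> = (\<Sum>w\<in>?L. of_bool (descent_composition w = \<alpha>))"
    proof (intro sum.cong refl)
      fix w
      have "fundamental \<alpha> = fundamental (descent_composition w) \<longleftrightarrow> descent_composition w = \<alpha>"
        using inj_on_fundamental \<alpha> descent_composition(1) by (metis inj_on_eq_iff)
      then show "series.representation ?B (fundamental (descent_composition w)) (fundamental \<alpha>) =
          of_bool (descent_composition w = \<alpha>)"
        by (subst series.representation_basis)
          (auto simp: independent_fundamental descent_composition)
    qed
    finally show ?thesis
      using finite_linear_extensions by (simp add: sum.If_cases of_bool_def Int_def)
  qed
  have "L_coeff (P_gf n P) \<alpha> \<noteq> 0 \<longleftrightarrow> \<alpha> \<in> descent_composition ` ?L" if "\<alpha> \<in> compositions" for \<alpha>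
    unfolding coeff[OF that] using finite_linear_extensions by (auto simp: card_eq_0_iff)
  then show ?thesis using descent_composition(1) by (auto simp: supp_L_def)
qed

section \<open>Unions of antichains\<close>

lemma max_antichain_union_Max:
  assumes "finite A"
  shows "\<exists>C. (\<forall>j<i. antichain A r (C j)) \<and> max_antichain_union A r i = card (\<Union>j<i. C j)"
    and "\<And>C. \<forall>j<i. antichain A r (C j) \<Longrightarrow> card (\<Union>j<i. C j) \<le> max_antichain_union A r i"
proof -
  let ?M = "{card (\<Union>j<i. C j) | C. \<forall>j<i. antichain A r (C j)}"
  have "card (\<Union>j<i. C j) \<le> card A" if "\<forall>j<i. antichain A r (C j)" for C
    using that assms by (intro card_mono) (auto simp: antichain_def)
  then have "?M \<subseteq> {..card A}" by auto
  then have fin: "finite ?M" using finite_subset by blast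
  have "antichain A r {}" by (simp add: antichain_def)
  then have "?M \<noteq> {}" by (auto intro!: exI[of _ "\<lambda>_. {}"])
  with fin have "Max ?M \<in> ?M" by (rule Max_in)
  then show "\<exists>C. (\<forall>j<i. antichain A r (C j)) \<and> max_antichain_union A r i = card (\<Union>j<i. C j)"
    unfolding max_antichain_union_def by blast
  show "card (\<Union>j<i. C j) \<le> max_antichain_union A r i" if "\<forall>j<i. antichain A r (C j)" for C
    unfolding max_antichain_union_def using fin that by (intro Max_ge) auto
qed

text \<open>A chain meets each antichain at most once, which bounds the height by \<open>i\<close>;
  a chain below \<open>x\<close> can be extended by any \<open>y\<close> of \<open>S\<close>
  strictly above \<open>x\<close>, which gives the strict increase.\<close>

lemma antichain_union_height:
  fixes A :: "'a set" and i :: nat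
  assumes r: "partial_order_on A r" and A: "finite A"
    and C: "\<forall>j<i. antichain A r (C j)"
  defines "S \<equiv> \<Union>j<i. C j"
  shows "\<exists>h. (\<forall>x\<in>S. 0 < h x) \<and> (\<forall>x. h x \<le> i) \<and>
    (\<forall>x y. (x, y) \<in> r \<longrightarrow> h x \<le> h y \<and> (x \<noteq> y \<and> y \<in> S \<longrightarrow> h x < h y))"
proof -
  have refl: "(x, x) \<in> r" if "x \<in> A" for x
    using r that by (auto simp: partial_order_on_def preorder_on_def refl_on_def)
  have tr: "(x, z) \<in> r" if "(x, y) \<in> r" "(y, z) \<in> r" for x y z
    using r that by (auto simp: partial_order_on_def preorder_on_def dest: transD)
  have anti: "x = y" if "(x, y) \<in> r" "(y, x) \<in> r" for x y
    using r that by (auto simp: partial_order_on_def dest: antisymD)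
  have SA: "S \<subseteq> A" using C by (auto simp: S_def antichain_def)
  define chains where "chains x =
    {K. K \<subseteq> S \<and> (\<forall>a\<in>K. (a, x) \<in> r) \<and> (\<forall>a\<in>K. \<forall>b\<in>K. (a, b) \<in> r \<or> (b, a) \<in> r)}" for x
  define h where "h x = Max (card ` chains x)" for x
  have fin: "finite (chains x)" for x
    using SA A by (intro finite_subset[of "chains x" "Pow S"]) (auto simp: chains_def intro: finite_subset)
  \<comment> \<open>The empty chain counts, so elements with nothing of \<open>S\<close> below them
    get height 0.\<close>
  have ne: "{} \<in> chains x" for x by (simp add: chains_def)
  have ge: "card K \<le> h x" if "K \<in> chains x" for K x
    unfolding h_def using fin that by (intro Max_ge) auto
  have attained: "\<exists>K \<in> chains x. h x = card K" for x
    using Max_in[of "card ` chains x"] fin[of x] ne[of x] unfolding h_def by blast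
  have fK: "finite K" if "K \<in> chains x" for K x
    using that SA A by (auto simp: chains_def intro: finite_subset)
  have "0 < h x" if "x \<in> S" for x
  proof -
    have "{x} \<in> chains x" using that SA refl by (auto simp: chains_def)
    then show ?thesis using ge by force
  qed
  moreover have "h x \<le> i" for x
  proof -
    obtain K where K: "K \<in> chains x" "h x = card K" using attained by blast
    then have "\<exists>j. j < i \<and> a \<in> C j" if "a \<in> K" for a
      using that by (auto simp: chains_def S_def)
    \<comment> \<open>\<open>c\<close> picks for each chain element an antichain containing it;
      comparable elements of one antichain coincide, so \<open>c\<close> is injective.\<close>
    then obtain c where c: "\<And>a. a \<in> K \<Longrightarrow> c a < i \<and> a \<in> C (c a)" by metis
    have "inj_on c K"
    proof (rule inj_onI)
      fix a b assume *: "a \<in> K" "b \<in> K" "c a = c b"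
      then have "a \<in> C (c a)" "b \<in> C (c a)" "antichain A r (C (c a))" using c C by metis+
      moreover have "(a, b) \<in> r \<or> (b, a) \<in> r" using K * by (auto simp: chains_def)
      ultimately show "a = b" by (auto simp: antichain_def)
    qed
    then have "card K \<le> card {..<i}" using c by (intro card_inj_on_le[of c]) auto
    with K show ?thesis by simp
  qed
  moreover have "h x \<le> h y" if xy: "(x, y) \<in> r" for x y
  proof -
    obtain K where K: "K \<in> chains x" "h x = card K" using attained by blast
    then have "K \<in> chains y" using tr xy by (auto simp: chains_def)
    with K ge show ?thesis by simp
  qed
  moreover have "h x < h y" if xy: "(x, y) \<in> r" "x \<noteq> y" "y \<in> S" for x y
  proof -
    obtain K where K: "K \<in> chains x" "h x = card K" using attained by blast
    then have "insert y K \<in> chains y"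
      using tr xy refl SA by (auto simp: chains_def)
    moreover have "y \<notin> K" using K anti xy by (auto simp: chains_def)
    ultimately show ?thesis using ge[of "insert y K" y] K fK by simp
  qed
  ultimately show ?thesis by blast
qed

text \<open>This turns antichains into data that depend only on a descent set: all positions of
  \<open>I j\<close> lie in one run of consecutive descents.\<close>

lemma linear_extension_of_antichains:
  fixes n i :: nat
  assumes P: "naturally_labeled n P" and C: "\<forall>j<i. antichain {1..n} P (C j)"
  shows "\<exists>w \<in> linear_extensions n P. \<exists>I. card (\<Union>j<i. I j) = card (\<Union>j<i. C j) \<and>
    (\<forall>j<i. I j \<subseteq> {..<n} \<and> (\<forall>p \<in> I j. \<forall>q \<in> I j. {p<..q} \<subseteq> descents w))"
proof -
  define S where "S = (\<Union>j<i. C j)"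
  have po: "partial_order_on {1..n} P" and nat_lab: "\<And>x y. (x, y) \<in> P \<Longrightarrow> x \<le> y"
    using P by (auto simp: naturally_labeled_def)
  have PD: "x \<in> {1..n}" "y \<in> {1..n}" if "(x, y) \<in> P" for x y
    using po that by (auto simp: partial_order_on_def preorder_on_def refl_on_def)
  have SA: "S \<subseteq> {1..n}" using C by (auto simp: S_def antichain_def)
  obtain h where "(\<forall>x\<in>S. 0 < h x) \<and> (\<forall>x. h x \<le> i) \<and>
    (\<forall>x y. (x, y) \<in> P \<longrightarrow> h x \<le> h y \<and> (x \<noteq> y \<and> y \<in> S \<longrightarrow> h x < h y))"
    unfolding S_def by (rule exE[OF antichain_union_height[OF po finite_atLeastAtMost C]])
  then have h: "\<And>x. x \<in> S \<Longrightarrow> 0 < h x" "\<And>x. h x \<le> i"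
    "\<And>x y. (x, y) \<in> P \<Longrightarrow> h x \<le> h y"
    "\<And>x y. (x, y) \<in> P \<Longrightarrow> x \<noteq> y \<Longrightarrow> y \<in> S \<Longrightarrow> h x < h y"
    by simp_all
  \<comment> \<open>The factor 2 leaves room to put the elements of \<open>S\<close> before the
    others within each level.\<close>
  define a where "a x = 2 * h x + of_bool (x \<notin> S)" for x
  \<comment> \<open>The reflection \<open>n - x\<close> lists \<open>S\<close> in decreasing order;
    the subtraction does not truncate, as labels are at most \<open>n\<close>.\<close>
  define b where "b x = (if x \<in> S then n - x else x)" for x
  define K where "K = lex_key n a b"
  \<comment> \<open>The parity of the key reveals membership in \<open>S\<close>, and its half the
    level.\<close>
  have a_eq: "h x = h y \<and> (x \<in> S \<longleftrightarrow> y \<in> S)" if "a x = a y" for x y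
    using that unfolding a_def of_bool_def by (auto split: if_splits; presburger)
  have less: "K x < K y \<longleftrightarrow> a x < a y \<or> a x = a y \<and> b x < b y"
    if "x \<in> {1..n}" "y \<in> {1..n}" for x y
    unfolding K_def using that by (intro lex_key_less_iff) (auto simp: b_def)
  have "x = y" if "x \<in> {1..n}" "y \<in> {1..n}" "\<not> K x < K y" "\<not> K y < K x" for x y
  proof -
    have "a x = a y" "b x = b y" using less that by force+
    with a_eq[of x y] that show ?thesis by (auto simp: b_def split: if_splits)
  qed
  then have inj: "inj_on K {1..n}" by (auto intro!: inj_onI)
  define w where "w = sort_key K [1..<Suc n]"
  note w = sort_key_inj[OF inj, folded w_def]
  have w_in: "w ! p \<in> {1..n}" if "p < n" for p using that w by (metis nth_mem)
  have "(w ! q, w ! p) \<notin> P" if pq: "p < q" "q < n" for p q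
  proof
    let ?x = "w ! q" and ?y = "w ! p"
    assume xy: "(?x, ?y) \<in> P"
    have "?x \<noteq> ?y" using pq w by (simp add: nth_eq_iff_index_eq)
    have "\<not> K ?y < K ?x"
    proof (cases "h ?x < h ?y")
      case True
      then have "a ?x < a ?y" by (auto simp: a_def)
      then show ?thesis using less PD xy by (meson less_not_sym)
    next
      case False
      \<comment> \<open>Going up to an element of \<open>S\<close> would raise the height. So
        \<open>?x\<close> comes first, either as an element of \<open>S\<close> or by its smaller
        label.\<close>
      then have "?y \<notin> S" "h ?x = h ?y"
        using h(3,4)[OF xy] \<open>?x \<noteq> ?y\<close> by force+
      then have "a ?x < a ?y \<or> a ?x = a ?y \<and> b ?x \<le> b ?y"
        using nat_lab[OF xy] by (auto simp: a_def b_def)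
      then show ?thesis using less[of ?y ?x] PD[OF xy] by auto
    qed
    then show False using w(4) pq by blast
  qed
  then have "w \<in> linear_extensions n P" using w by (simp add: linear_extensions_def)
  \<comment> \<open>Elements of \<open>S\<close> have heights 1 to \<open>i\<close>, so level
    \<open>Suc j\<close> is indexed by \<open>j < i\<close>.\<close>
  define I where "I j = {p. p < n \<and> w ! p \<in> S \<and> h (w ! p) = Suc j}" for j
  have "(\<Union>j<i. I j) = {p. p < n \<and> w ! p \<in> S}"
  proof -
    have "h (w ! p) = Suc (h (w ! p) - 1) \<and> h (w ! p) - 1 < i" if "w ! p \<in> S" for p
      using h(1)[OF that] h(2)[of "w ! p"] by auto
    then show ?thesis by (fastforce simp: I_def)
  qed
  moreover have "card {p. p < n \<and> w ! p \<in> S} = card S"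
  proof (rule bij_betw_same_card[of "(!) w"])
    have "\<exists>p<n. w ! p = x" if "x \<in> S" for x
      using that SA w by (metis in_set_conv_nth subsetD)
    then show "bij_betw ((!) w) {p. p < n \<and> w ! p \<in> S} S"
      using w by (auto simp: bij_betw_def inj_on_def nth_eq_iff_index_eq)
  qed
  ultimately have card: "card (\<Union>j<i. I j) = card S" by simp
  have run: "s \<in> descents w" if *: "p \<in> I j" "q \<in> I j" "p < s" "s \<le> q" for j p q s
  proof -
    have "q < n" using * by (simp add: I_def)
    have a_mono: "a (w ! k) \<le> a (w ! l)" if "k \<le> l" "l < n" for k l
    proof (cases "k = l")
      case False
      then have "K (w ! k) < K (w ! l)" using that w(4) by simp
      then show ?thesis using that w_in less[of "w ! k" "w ! l"] by auto
    qed simp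
    have "a (w ! p) = a (w ! q)" using * by (simp add: I_def a_def)
    \<comment> \<open>The primary key is weakly increasing along \<open>w\<close>. Equal at both
      ends, it is constant between them, so the whole stretch lies in \<open>S\<close> at one level
      and its labels fall.\<close>
    then have const: "a (w ! k) = a (w ! q)" if "p \<le> k" "k \<le> q" for k
      using a_mono[of p k] a_mono[of k q] that \<open>q < n\<close> by simp
    have eq: "a (w ! (s - 1)) = a (w ! q)" "a (w ! s) = a (w ! q)"
      by (rule const; use *(3,4) in linarith)+
    have "w ! (s - 1) \<in> S" "w ! s \<in> S"
      using a_eq[OF eq(1)] a_eq[OF eq(2)] *(2) by (simp_all add: I_def)
    moreover have "K (w ! (s - 1)) < K (w ! s)" using * \<open>q < n\<close> by (intro w(4)) auto
    moreover have "w ! (s - 1) \<in> {1..n}" "w ! s \<in> {1..n}"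
      by (rule w_in; use * \<open>q < n\<close> in linarith)+
    ultimately have "n - w ! (s - 1) < n - w ! s" using less eq by (auto simp: b_def)
    then show ?thesis using * \<open>q < n\<close> w(3) by (auto simp: descents_def)
  qed
  have "I j \<subseteq> {..<n}" for j by (auto simp: I_def)
  moreover have "{p<..q} \<subseteq> descents w" if "p \<in> I j" "q \<in> I j" for j p q
    using run[OF that] by auto
  ultimately show ?thesis
    using \<open>w \<in> linear_extensions n P\<close> card unfolding S_def by blast
qed

text \<open>Labels fall along a run of descents, so natural labeling forbids an earlier entry below
  a later one; the opposite relation is excluded in a linear extension.\<close>

lemma descent_run_antichain:
  assumes P: "naturally_labeled n P" and w: "w \<in> linear_extensions n P"
    and I: "I \<subseteq> {..<n}" "\<And>p q. p \<in> I \<Longrightarrow> q \<in> I \<Longrightarrow> {p<..q} \<subseteq> descents w"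
  shows "antichain {1..n} P ((!) w ` I)"
proof -
  have w': "set w = {1..n}" "length w = n" "\<And>p q. p < q \<Longrightarrow> q < n \<Longrightarrow> (w ! q, w ! p) \<notin> P"
    using w length_linear_extension by (auto simp: linear_extensions_def)
  have "p = q" if pq: "p \<in> I" "q \<in> I" "(w ! p, w ! q) \<in> P" for p q
  proof (cases p q rule: linorder_cases)
    case less
    then have "w ! q < w ! p" using I(2)[OF pq(1,2)] by (intro descents_run_decreasing) auto
    moreover have "w ! p \<le> w ! q" using P pq by (simp add: naturally_labeled_def)
    ultimately show ?thesis by simp
  next
    case greater
    then show ?thesis using w'(3) pq I(1) by blast
  qed
  moreover have "w ! p \<in> {1..n}" if "p \<in> I" for p
    using that I(1) w'(1,2) nth_mem[of p w] by auto
  ultimately show ?thesis unfolding antichain_def by blast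
qed

text \<open>The positions of the descent runs are carried over to a linear extension of
  \<open>Q\<close> with the same descents. There they give antichains, and injectivity of the word
  preserves the size of the union.\<close>

lemma max_antichain_union_le:
  assumes P: "naturally_labeled n P" and Q: "naturally_labeled n Q"
    and sub: "descents ` linear_extensions n P \<subseteq> descents ` linear_extensions n Q"
  shows "max_antichain_union {1..n} P i \<le> max_antichain_union {1..n} Q i"
proof -
  obtain C where C: "\<forall>j<i. antichain {1..n} P (C j)"
      "max_antichain_union {1..n} P i = card (\<Union>j<i. C j)"
    using max_antichain_union_Max(1)[of "{1..n}" i P] by auto
  obtain w I where w: "w \<in> linear_extensions n P"
    and card: "card (\<Union>j<i. I j) = card (\<Union>j<i. C j)"
    and I: "\<forall>j<i. I j \<subseteq> {..<n} \<and> (\<forall>p \<in> I j. \<forall>q \<in> I j. {p<..q} \<subseteq> descents w)"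
    using linear_extension_of_antichains[OF P C(1)] by blast
  obtain v where v: "v \<in> linear_extensions n Q" "descents v = descents w"
    using sub w by (metis (no_types, lifting) image_iff subsetD)
  have "antichain {1..n} Q ((!) v ` I j)" if "j < i" for j
    using I that v(2) by (intro descent_run_antichain[OF Q v(1)]) auto
  then have "card (\<Union>j<i. (!) v ` I j) \<le> max_antichain_union {1..n} Q i"
    by (intro max_antichain_union_Max(2)) simp_all
  moreover have "card (\<Union>j<i. (!) v ` I j) = card (\<Union>j<i. I j)"
  proof -
    have "inj_on ((!) v) {..<n}"
      using v(1) length_linear_extension[OF v(1)]
      by (auto simp: inj_on_def linear_extensions_def nth_eq_iff_index_eq)
    then have "inj_on ((!) v) (\<Union>j<i. I j)" by (rule inj_on_subset) (use I in blast)
    then show ?thesis by (simp add: card_image flip: image_UN)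
  qed
  ultimately show ?thesis using C(2) card by simp
qed

text \<open>Ensures that the support is nonempty, so that the size of the ground set can be read off
  from it.\<close>

lemma upt_in_linear_extensions:
  assumes "naturally_labeled n P"
  shows "[1..<Suc n] \<in> linear_extensions n P"
  using assms by (fastforce simp: linear_extensions_def naturally_labeled_def simp del: upt_Suc)

theorem theorem3p11:
  fixes m n :: nat and P Q :: "nat rel"
  assumes "naturally_labeled m P" and "naturally_labeled n Q"
    and "supp_L (P_gf m P) = supp_L (P_gf n Q)"
  shows "shape {1..m} P = shape {1..n} Q"
proof -
  have eq: "descent_composition ` linear_extensions m P =
      descent_composition ` linear_extensions n Q"
    using assms by (simp add: supp_L_P_gf)
  \<comment> \<open>All compositions in the support have the size of the ground set as their sum, so
    equal supports force \<open>m = n\<close>.\<close>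
  have "sum_list ` descent_composition ` linear_extensions k R = {k}" if "naturally_labeled k R" for k R
    using upt_in_linear_extensions[OF that]
    by (force simp: image_image descent_composition length_linear_extension)
  then have "m = n" using assms eq by (metis singleton_inject)
  have "descents ` linear_extensions m P = descents ` linear_extensions n Q"
    using arg_cong[OF eq, of "image descent_set"] by (simp add: image_image descent_composition)
  then have "max_antichain_union {1..m} P i = max_antichain_union {1..n} Q i" for i
    using max_antichain_union_le assms \<open>m = n\<close> by (metis order_antisym order_refl)
  \<comment> \<open>\<open>shape\<close> depends on the poset only through these antichain
    numbers.\<close>
  then show ?thesis by (simp add: shape_def)
qed

end
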